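(* Let $q\geq 0$ and $n\geq 0$ be integers. Paul has a winning strategy for the $q$-round pathological liar game with $2$ lies and initial state $(n,0,0)$ if and only if $$2^q\leq n\binom{q}{\leq 2}-A\binom{q-1}{2}-B\binom{q-2}{1},$$ where $A=n\bmod 2$ and $$B=\begin{cases} 0 & \text{if } n\equiv 0\pmod 4,\\ 2\cdot(q\bmod 2) & \text{if } n\equiv 1\pmod 4,\\ (1-q^3)\bmod 4 & \text{if } n\equiv 2\pmod 4,\\ (1+q^3)\bmod 4 & \text{if } n\equiv 3\pmod 4.\end{cases}$$
   Context: Pathological liar game with $2$ lies: a state is a vector $(x_0,x_1,x_2)$ of nonnegative integers. In each of $q$ rounds Paul chooses a legal question $(a_0,a_1,a_2)$ with integers $0\leq a_i\leq x_i$, and Carole answers Y or N; the new state is $(a_0,\,a_1+x_0-a_0,\,a_2+x_1-a_1)$ after Y, or $(x_0-a_0,\,x_1-a_1+a_0,\,x_2-a_2+a_1)$ after N. Paul wins iff after $q$ rounds $x_0+x_1+x_2\geq 1$. Notation: $\binom{q}{\leq 2}=1+q+\binom{q}{2}$; "$m\bmod 4$" denotes the least nonnegative residue. *)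

theory Defs
  imports Main
begin

definition yes_state :: "nat \<times> nat \<times> nat \<Rightarrow> nat \<times> nat \<times> nat \<Rightarrow> nat \<times> nat \<times> nat" where
  "yes_state x a = (case x of (x0, x1, x2) \<Rightarrow> case a of (a0, a1, a2) \<Rightarrow>
      (a0, a1 + x0 - a0, a2 + x1 - a1))"

definition no_state :: "nat \<times> nat \<times> nat \<Rightarrow> nat \<times> nat \<times> nat \<Rightarrow> nat \<times> nat \<times> nat" where
  "no_state x a = (case x of (x0, x1, x2) \<Rightarrow> case a of (a0, a1, a2) \<Rightarrow>
      (x0 - a0, x1 - a1 + a0, x2 - a2 + a1))"

definition legal_question :: "nat \<times> nat \<times> nat \<Rightarrow> nat \<times> nat \<times> nat \<Rightarrow> bool" where
  "legal_question x a = (case x of (x0, x1, x2) \<Rightarrow> case a of (a0, a1, a2) \<Rightarrow>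
      a0 \<le> x0 \<and> a1 \<le> x1 \<and> a2 \<le> x2)"

fun paul_wins :: "nat \<Rightarrow> nat \<times> nat \<times> nat \<Rightarrow> bool" where
  "paul_wins 0 x = (case x of (x0, x1, x2) \<Rightarrow> x0 + x1 + x2 \<ge> 1)"
| "paul_wins (Suc q) x = (\<exists>a. legal_question x a \<and>
      paul_wins q (yes_state x a) \<and> paul_wins q (no_state x a))"

end

theory Submission
  imports Defs
begin

text \<open>
  With \<open>r\<close> rounds left, a chip that may still survive \<open>j\<close> lies has weight the number of answer
  patterns of length \<open>r\<close> with at most \<open>j\<close> lies. The two successor weights add up to the weight
  of the state, so a winning state has weight at least \<open>2 ^ r\<close>, and Paul wants to split the
  weight evenly. Writing \<open>d\<^sub>i = 2 a\<^sub>i - x\<^sub>i\<close>, the imbalance of a question asked with \<open>r + 1\<close> rounds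
  left is \<open>d\<^sub>0 (r choose 2) + d\<^sub>1 r + d\<^sub>2\<close>, where \<open>d\<^sub>i\<close> has the parity of \<open>x\<^sub>i\<close>.

  From \<open>(n, 0, 0)\<close> the first question can only be unbalanced through the parity of \<open>n\<close>, which
  costs the term with \<open>A\<close>. In the second round \<open>x\<^sub>2 = 0\<close>, so the imbalance is a multiple of
  half the number of remaining rounds, and the parities of \<open>d\<^sub>0\<close> and \<open>d\<^sub>1\<close> force the
  term with \<open>B\<close>. After that, for \<open>q \<ge> 16\<close>, \<open>x\<^sub>2\<close> is large enough to make the imbalance
  at most 1 in every round, and this persists until 6 rounds are left. These last
  rounds, and all games with \<open>q \<le> 15\<close>, are settled by an explicit table of questions; moving
  chips to the left or adding chips never hurts Paul, so only minimal states are listed.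
\<close>

subsection \<open>Monotonicity\<close>

text \<open>Comparing partial sums expresses that \<open>y\<close> arises from \<open>x\<close> by
  adding chips on the right and moving chips to the left.\<close>

definition dominates :: "nat \<times> nat \<times> nat \<Rightarrow> nat \<times> nat \<times> nat \<Rightarrow> bool" where
  "dominates y x = (case y of (y0, y1, y2) \<Rightarrow> case x of (x0, x1, x2) \<Rightarrow>
      x0 \<le> y0 \<and> x0 + x1 \<le> y0 + y1 \<and> x0 + x1 + x2 \<le> y0 + y1 + y2)"

lemma paul_wins_step:
  assumes "a0 \<le> x0" "a1 \<le> x1" "a2 \<le> x2"
    and "paul_wins q (a0, a1 + (x0 - a0), a2 + (x1 - a1))"
    and "paul_wins q (x0 - a0, x1 - a1 + a0, x2 - a2 + a1)"
  shows "paul_wins (Suc q) (x0, x1, x2)"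
proof -
  have "legal_question (x0, x1, x2) (a0, a1, a2)"
    using assms by (simp add: legal_question_def)
  moreover have "paul_wins q (yes_state (x0, x1, x2) (a0, a1, a2))"
    "paul_wins q (no_state (x0, x1, x2) (a0, a1, a2))"
    using assms by (simp_all add: yes_state_def no_state_def)
  ultimately show ?thesis
    by auto
qed

lemma paul_wins_stepE:
  assumes "paul_wins (Suc q) (x0, x1, x2)"
  obtains a0 a1 a2 where "a0 \<le> x0" "a1 \<le> x1" "a2 \<le> x2"
    "paul_wins q (a0, a1 + (x0 - a0), a2 + (x1 - a1))"
    "paul_wins q (x0 - a0, x1 - a1 + a0, x2 - a2 + a1)"
  using assms by (auto simp: legal_question_def yes_state_def no_state_def)

text \<open>The three improvements of a single chip need each other in the induction: an answer
  against the chip drops both versions of it by one level, so that a move from level 1 to 0 becomes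
  one from 2 to 1, and a move from 2 to 1 becomes an added chip.\<close>

lemma paul_wins_improve_chip:
  "(paul_wins q (x0, x1, x2) \<longrightarrow> paul_wins q (x0, x1, Suc x2)) \<and>
   (paul_wins q (x0, x1, Suc x2) \<longrightarrow> paul_wins q (x0, Suc x1, x2)) \<and>
   (paul_wins q (x0, Suc x1, x2) \<longrightarrow> paul_wins q (Suc x0, x1, x2))"
proof (induction q arbitrary: x0 x1 x2)
  case 0
  show ?case by simp
next
  case (Suc q)
  have add: "paul_wins q (x0, x1, Suc x2)" if "paul_wins q (x0, x1, x2)" for x0 x1 x2
    using Suc.IH that by blast
  have up1: "paul_wins q (x0, Suc x1, x2)" if "paul_wins q (x0, x1, Suc x2)" for x0 x1 x2
    using Suc.IH that by blast
  have up0: "paul_wins q (Suc x0, x1, x2)" if "paul_wins q (x0, Suc x1, x2)" for x0 x1 x2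
    using Suc.IH that by blast
  have "paul_wins (Suc q) (x0, x1, Suc x2)" if win: "paul_wins (Suc q) (x0, x1, x2)"
    using win
  proof (rule paul_wins_stepE)
    fix a0 a1 a2
    assume a: "a0 \<le> x0" "a1 \<le> x1" "a2 \<le> x2"
      and y: "paul_wins q (a0, a1 + (x0 - a0), a2 + (x1 - a1))"
      and n: "paul_wins q (x0 - a0, x1 - a1 + a0, x2 - a2 + a1)"
    show ?thesis
      using a y add[OF n] by (intro paul_wins_step[of a0 _ a1 _ a2]) (simp_all add: Suc_diff_le)
  qed
  moreover have "paul_wins (Suc q) (x0, Suc x1, x2)"
    if win: "paul_wins (Suc q) (x0, x1, Suc x2)"
    using win
  proof (rule paul_wins_stepE)
    fix a0 a1 a2
    assume a: "a0 \<le> x0" "a1 \<le> x1" "a2 \<le> Suc x2"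
      and y: "paul_wins q (a0, a1 + (x0 - a0), a2 + (x1 - a1))"
      and n: "paul_wins q (x0 - a0, x1 - a1 + a0, Suc x2 - a2 + a1)"
    show ?thesis
    \<comment> \<open>If some chip of level 2 lies outside the question, it serves as the moved one
      and the question stays. Otherwise all of them lie inside, and the moved chip is asked about at
      its new level.\<close>
    proof (cases "a2 \<le> x2")
      case True
      show ?thesis
        using a True add[OF y] up1[of "x0 - a0" "x1 - a1 + a0" "x2 - a2 + a1"] n
        by (intro paul_wins_step[of a0 _ a1 _ a2]) (simp_all add: Suc_diff_le)
    next
      case False
      then have a2: "a2 = Suc x2"
        using a by simp
      show ?thesis
        using a a2 up1[of a0 "a1 + (x0 - a0)" "x2 + (x1 - a1)"] y add[OF n]
        by (intro paul_wins_step[of a0 _ "Suc a1" _ x2]) simp_all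
    qed
  qed
  moreover have "paul_wins (Suc q) (Suc x0, x1, x2)"
    if win: "paul_wins (Suc q) (x0, Suc x1, x2)"
    using win
  proof (rule paul_wins_stepE)
    fix a0 a1 a2
    assume a: "a0 \<le> x0" "a1 \<le> Suc x1" "a2 \<le> x2"
      and y: "paul_wins q (a0, a1 + (x0 - a0), a2 + (Suc x1 - a1))"
      and n: "paul_wins q (x0 - a0, Suc x1 - a1 + a0, x2 - a2 + a1)"
    show ?thesis
    proof (cases "a1 \<le> x1")
      case True
      show ?thesis
        using a True up1[of a0 "a1 + (x0 - a0)" "a2 + (x1 - a1)"] y
          up0[of "x0 - a0" "x1 - a1 + a0" "x2 - a2 + a1"] n
        by (intro paul_wins_step[of a0 _ a1 _ a2]) (simp_all add: Suc_diff_le)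
    next
      case False
      then have a1: "a1 = Suc x1"
        using a by simp
      show ?thesis
        using a a1 up0[of a0 "x1 + (x0 - a0)" a2] y up1[of "x0 - a0" a0 "x2 - a2 + x1"] n
        by (intro paul_wins_step[of "Suc a0" _ x1 _ a2]) simp_all
    qed
  qed
  ultimately show ?case by blast
qed

text \<open>All missing chips are added on the right; the surplus is then carried to the middle and
  from there to the left, one chip at a time.\<close>

lemma paul_wins_mono:
  assumes "paul_wins q x" "dominates y x"
  shows "paul_wins q y"
proof -
  obtain x0 x1 x2 y0 y1 y2 where xy: "x = (x0, x1, x2)" "y = (y0, y1, y2)"
    by (metis prod_cases3)
  have le: "x0 \<le> y0" "x0 + x1 \<le> y0 + y1" "x0 + x1 + x2 \<le> y0 + y1 + y2"
    using assms(2) by (simp_all add: xy dominates_def)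
  have add: "paul_wins q (u, v, w) \<Longrightarrow> paul_wins q (u, v, w + k)" for u v w k
    by (induction k) (use paul_wins_improve_chip in auto)
  have up1: "paul_wins q (u, v, w + k) \<Longrightarrow> paul_wins q (u, v + k, w)" for u v w k
  proof (induction k arbitrary: w)
    case (Suc k)
    then have "paul_wins q (u, v + k, Suc w)"
      by simp
    then show ?case using paul_wins_improve_chip by simp
  qed simp
  have up0: "paul_wins q (u, v + k, w) \<Longrightarrow> paul_wins q (u + k, v, w)" for u v w k
  proof (induction k arbitrary: v)
    case (Suc k)
    then have "paul_wins q (u + k, Suc v, w)"
      by simp
    then show ?case using paul_wins_improve_chip by simp
  qed simp
  have "paul_wins q (x0, x1, x2 + (y0 + y1 + y2 - (x0 + x1 + x2)))"
    using add assms(1) xy by simp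
  also have "x2 + (y0 + y1 + y2 - (x0 + x1 + x2)) = y2 + (y0 + y1 - (x0 + x1))"
    using le by simp
  finally have "paul_wins q (x0, x1 + (y0 + y1 - (x0 + x1)), y2)"
    by (rule up1)
  also have "x1 + (y0 + y1 - (x0 + x1)) = y1 + (y0 - x0)"
    using le by simp
  finally have "paul_wins q (x0 + (y0 - x0), y1, y2)"
    by (rule up0)
  then show ?thesis
    using le xy by simp
qed

subsection \<open>Certificates for short games\<close>

text \<open>The argument \<open>won\<close> holds states known to win with one round fewer.
  Successors need only dominate one of them, which keeps the lists short.\<close>

fun valid_certificate ::
  "(nat \<times> nat \<times> nat) list \<Rightarrow> ((nat \<times> nat \<times> nat) \<times> (nat \<times> nat \<times> nat)) list list \<Rightarrow> bool" where
  "valid_certificate won [] = True"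
| "valid_certificate won (l # ls) =
    (list_all (\<lambda>(x, a). legal_question x a \<and> list_ex (dominates (yes_state x a)) won \<and>
        list_ex (dominates (no_state x a)) won) l \<and>
     valid_certificate (map fst l) ls)"

lemma valid_certificate_sound:
  assumes "valid_certificate won ls" "\<forall>x \<in> set won. paul_wins q x"
    and "i < length ls" "(x, a) \<in> set (ls ! i)"
  shows "paul_wins (Suc (q + i)) x"
  using assms
proof (induction ls arbitrary: won q i)
  case (Cons l ls)
  have won: "paul_wins (Suc q) x" if "(x, a) \<in> set l" for x a
  proof -
    have "legal_question x a" "list_ex (dominates (yes_state x a)) won"
      "list_ex (dominates (no_state x a)) won"
      using Cons.prems(1) that by (auto simp: list_all_iff)
    moreover from this have "paul_wins q (yes_state x a)" "paul_wins q (no_state x a)"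
      using Cons.prems(2) paul_wins_mono unfolding list_ex_iff by blast+
    ultimately show ?thesis
      unfolding paul_wins.simps by blast
  qed
  show ?case
  proof (cases i)
    case 0
    then show ?thesis
      using Cons.prems(4) won by simp
  next
    case (Suc j)
    have "\<forall>x \<in> set (map fst l). paul_wins (Suc q) x"
      using won by fastforce
    then have "paul_wins (Suc (Suc q + j)) x"
      using Cons.prems Suc by (intro Cons.IH[of "map fst l" "Suc q" j]) simp_all
    then show ?thesis
      using Suc by simp
  qed
qed simp

text \<open>Entry \<open>i\<close> lists winning states for \<open>Suc i\<close> rounds, each with a winning question.\<close>

definition small_game_certificate ::
  "((nat \<times> nat \<times> nat) \<times> (nat \<times> nat \<times> nat)) list list" where
  "small_game_certificate = [
    [((0,0,2),(0,0,1)), ((0,1,0),(0,0,0))],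
    [((0,0,4),(0,0,2)), ((0,1,1),(0,0,1)), ((1,0,0),(1,0,0))],
    [((0,0,8),(0,0,4)), ((0,1,4),(0,0,3)), ((0,2,0),(0,1,0)), ((0,2,1),(0,1,0)),
     ((1,0,1),(1,0,0))],
    [((0,0,16),(0,0,8)), ((0,1,11),(0,0,7)), ((0,2,6),(0,1,3)), ((0,3,2),(0,1,2)),
     ((1,0,5),(1,0,1)), ((1,1,0),(1,0,0)), ((2,0,0),(1,0,0))],
    [((0,0,32),(0,0,16)), ((0,1,26),(0,0,15)), ((0,2,20),(0,1,10)), ((0,3,14),(0,1,9)),
     ((0,4,8),(0,2,4)), ((0,5,4),(0,2,4)), ((1,0,16),(1,0,5)), ((1,1,10),(1,0,4)),
     ((1,2,5),(1,0,3)), ((1,3,1),(1,1,0)), ((1,3,3),(1,1,1)), ((1,4,1),(1,1,1)),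
     ((2,0,0),(1,0,0))],
    [((0,0,64),(0,0,32)), ((0,1,57),(0,0,31)), ((0,2,50),(0,1,25)), ((0,3,43),(0,1,24)),
     ((0,4,36),(0,2,18)), ((0,5,29),(0,2,17)), ((0,6,22),(0,3,11)), ((0,7,15),(0,3,10)),
     ((0,8,8),(0,4,4)), ((0,9,5),(0,4,5)), ((1,0,42),(1,0,16)), ((1,1,35),(1,0,15)),
     ((1,2,28),(1,0,14)), ((1,3,21),(1,1,8)), ((1,4,14),(1,1,7)), ((1,5,8),(1,2,2)),
     ((1,6,5),(1,2,2)), ((2,3,4),(1,1,4)), ((2,4,2),(1,2,1)), ((3,3,0),(2,1,0)),
     ((4,0,0),(2,0,0))],
    [((1,8,35),(1,3,16)), ((1,9,27),(1,3,15)), ((1,9,28),(1,3,15)), ((1,10,20),(1,4,9)),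
     ((1,11,11),(1,4,7)), ((2,5,30),(1,2,18)), ((2,6,22),(1,3,11)), ((2,7,15),(1,3,10)),
     ((2,8,12),(1,4,6)), ((2,9,9),(1,4,7)), ((3,6,3),(2,2,0)), ((4,4,0),(2,2,0)),
     ((6,0,0),(3,0,0))],
    [((2,15,48),(1,7,27)), ((2,16,39),(1,8,19)), ((2,16,40),(1,8,20)), ((2,17,31),(1,8,19)),
     ((3,11,47),(2,4,23)), ((3,12,39),(2,5,16)), ((3,13,30),(2,5,15)), ((3,14,19),(2,5,13)),
     ((3,15,11),(2,6,6)), ((4,9,28),(2,4,17)), ((4,12,12),(2,6,6)), ((5,10,5),(3,4,0)),
     ((6,6,0),(3,3,0)), ((8,0,0),(4,0,0))],
    [((4,26,70),(2,13,35)), ((4,27,60),(2,13,34)), ((4,27,61),(2,13,34)),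
     ((4,28,53),(2,14,26)), ((5,22,64),(3,9,34)), ((5,23,56),(3,10,26)),
     ((5,24,46),(3,10,25)), ((5,25,37),(3,11,17)), ((6,21,31),(3,10,19)),
     ((6,22,17),(3,11,8)), ((7,17,22),(4,6,17)), ((8,16,8),(4,8,4)), ((10,10,0),(5,5,0)),
     ((12,0,0),(6,0,0))],
    [((8,45,85),(4,22,47)), ((9,40,85),(5,18,42)), ((9,43,57),(5,20,24)),
     ((10,37,66),(5,18,37)), ((10,38,55),(5,19,27)), ((11,35,34),(6,16,13)),
     ((12,30,33),(6,15,16)), ((13,26,13),(7,11,7)), ((16,16,0),(8,8,0)), ((20,0,0),(10,0,0))],
    [((17,68,102),(9,32,49)), ((19,61,62),(10,28,33)), ((20,56,55),(10,28,27)),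
     ((22,48,20),(11,24,10)), ((23,42,25),(12,19,10)), ((26,26,0),(13,13,0)),
     ((32,0,0),(16,0,0))],
    [((34,102,102),(17,51,51)), ((39,78,39),(20,37,14)), ((45,45,0),(23,20,0)),
     ((52,0,0),(26,0,0))],
    [((68,136,68),(34,68,34)), ((78,78,0),(39,39,0)), ((90,0,0),(45,0,0))],
    [((136,136,0),(68,68,0)), ((156,0,0),(78,0,0))],
    [((272,0,0),(136,0,0))]]"

lemma paul_wins_by_certificate:
  assumes "i < 15" "(x, a) \<in> set (small_game_certificate ! i)"
  shows "paul_wins (Suc i) x"
proof -
  \<comment> \<open>With no rounds left, a single chip on the right is the least winning
    state.\<close>
  have "valid_certificate [(0, 0, 1)] small_game_certificate"
    by code_simp
  moreover have "length small_game_certificate = 15"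
    by (simp add: small_game_certificate_def)
  ultimately show ?thesis
    using valid_certificate_sound[of "[(0, 0, 1)]" small_game_certificate 0 i x a] assms by simp
qed

subsection \<open>States with integer coordinates\<close>

text \<open>Integer coordinates avoid truncated subtraction in the parity and weight
  computations.\<close>

definition wins_from :: "nat \<Rightarrow> int \<Rightarrow> int \<Rightarrow> int \<Rightarrow> bool" where
  "wins_from r x0 x1 x2 \<longleftrightarrow>
     0 \<le> x0 \<and> 0 \<le> x1 \<and> 0 \<le> x2 \<and> paul_wins r (nat x0, nat x1, nat x2)"

lemma wins_from_of_nat [simp]:
  "wins_from r (int x0) (int x1) (int x2) \<longleftrightarrow> paul_wins r (x0, x1, x2)"
  by (simp add: wins_from_def)

lemma wins_from_mono:
  assumes "wins_from r x0 x1 x2" "x0 \<le> y0" "x0 + x1 \<le> y0 + y1"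
    "x0 + x1 + x2 \<le> y0 + y1 + y2" "0 \<le> y1" "0 \<le> y2"
  shows "wins_from r y0 y1 y2"
proof -
  have "dominates (nat y0, nat y1, nat y2) (nat x0, nat x1, nat x2)"
    using assms by (auto simp: dominates_def wins_from_def)
  then show ?thesis
    using assms paul_wins_mono unfolding wins_from_def by auto
qed

lemma wins_from_step:
  assumes "0 \<le> a0" "a0 \<le> x0" "0 \<le> a1" "a1 \<le> x1" "0 \<le> a2" "a2 \<le> x2"
    and "wins_from r a0 (a1 + x0 - a0) (a2 + x1 - a1)"
    and "wins_from r (x0 - a0) (x1 - a1 + a0) (x2 - a2 + a1)"
  shows "wins_from (Suc r) x0 x1 x2"
proof -
  obtain b0 b1 b2 where b: "a0 = int b0" "a1 = int b1" "a2 = int b2"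
    using assms(1,3,5) by (meson zero_le_imp_eq_int)
  obtain y0 y1 y2 where y: "x0 = int y0" "x1 = int y1" "x2 = int y2"
    using assms(1-6) by (meson order_trans zero_le_imp_eq_int)
  have le: "b0 \<le> y0" "b1 \<le> y1" "b2 \<le> y2"
    using assms(2,4,6) b y by simp_all
  then have "a1 + x0 - a0 = int (b1 + (y0 - b0))" "a2 + x1 - a1 = int (b2 + (y1 - b1))"
    "x0 - a0 = int (y0 - b0)" "x1 - a1 + a0 = int (y1 - b1 + b0)"
    "x2 - a2 + a1 = int (y2 - b2 + b1)"
    using b y by simp_all
  then have "paul_wins r (b0, b1 + (y0 - b0), b2 + (y1 - b1))"
    "paul_wins r (y0 - b0, y1 - b1 + b0, y2 - b2 + b1)"
    using assms(7,8) b wins_from_of_nat by metis+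
  then have "paul_wins (Suc r) (y0, y1, y2)"
    using le by (intro paul_wins_step)
  then show ?thesis
    using y by simp
qed

text \<open>The base of balanced play. The coefficients 22, 7, 1 are the chip weights with 6 rounds
  left, and the bounds on \<open>x2\<close> are those of \<open>well_stocked\<close> at
  \<open>r = 6\<close>. Each small \<open>x1\<close> has its table entry; for larger ones the bound
  on \<open>x2\<close> alone suffices.\<close>

lemma wins_from_6:
  assumes "0 \<le> x1" "64 \<le> 22 * x0 + 7 * x1 + x2"
    and "x0 = 0 \<and> 5 \<le> x2 \<or> x0 = 1 \<and> 8 \<le> x2"
  shows "wins_from 6 x0 x1 x2"
proof -
  have cert: "wins_from 6 (int u) (int v) (int w)"
    if "((u, v, w), a) \<in> set (small_game_certificate ! 5)" for u v w a
    using paul_wins_by_certificate[of 5] that by simp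
  note mem = small_game_certificate_def
  from assms(3) show ?thesis
  proof
    assume x: "x0 = 0 \<and> 5 \<le> x2"
    consider "x1 = 0" | "x1 = 1" | "x1 = 2" | "x1 = 3" | "x1 = 4" | "x1 = 5" | "x1 = 6"
      | "x1 = 7" | "x1 = 8" | "9 \<le> x1"
      using assms(1) by linarith
    then show ?thesis
    proof cases
      case 1
      then show ?thesis
        using assms(2) x by (intro wins_from_mono[OF cert[of 0 0 64]]) (auto simp: mem)
    next
      case 2
      then show ?thesis
        using assms(2) x by (intro wins_from_mono[OF cert[of 0 1 57]]) (auto simp: mem)
    next
      case 3
      then show ?thesis
        using assms(2) x by (intro wins_from_mono[OF cert[of 0 2 50]]) (auto simp: mem)
    next
      case 4
      then show ?thesis
        using assms(2) x by (intro wins_from_mono[OF cert[of 0 3 43]]) (auto simp: mem)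
    next
      case 5
      then show ?thesis
        using assms(2) x by (intro wins_from_mono[OF cert[of 0 4 36]]) (auto simp: mem)
    next
      case 6
      then show ?thesis
        using assms(2) x by (intro wins_from_mono[OF cert[of 0 5 29]]) (auto simp: mem)
    next
      case 7
      then show ?thesis
        using assms(2) x by (intro wins_from_mono[OF cert[of 0 6 22]]) (auto simp: mem)
    next
      case 8
      then show ?thesis
        using assms(2) x by (intro wins_from_mono[OF cert[of 0 7 15]]) (auto simp: mem)
    next
      case 9
      then show ?thesis
        using assms(2) x by (intro wins_from_mono[OF cert[of 0 8 8]]) (auto simp: mem)
    next
      case 10
      then show ?thesis
        using assms(2) x by (intro wins_from_mono[OF cert[of 0 9 5]]) (auto simp: mem)
    qed
  next
    assume x: "x0 = 1 \<and> 8 \<le> x2"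
    consider "x1 = 0" | "x1 = 1" | "x1 = 2" | "x1 = 3" | "x1 = 4" | "5 \<le> x1"
      using assms(1) by linarith
    then show ?thesis
    proof cases
      case 1
      then show ?thesis
        using assms(2) x by (intro wins_from_mono[OF cert[of 1 0 42]]) (auto simp: mem)
    next
      case 2
      then show ?thesis
        using assms(2) x by (intro wins_from_mono[OF cert[of 1 1 35]]) (auto simp: mem)
    next
      case 3
      then show ?thesis
        using assms(2) x by (intro wins_from_mono[OF cert[of 1 2 28]]) (auto simp: mem)
    next
      case 4
      then show ?thesis
        using assms(2) x by (intro wins_from_mono[OF cert[of 1 3 21]]) (auto simp: mem)
    next
      case 5
      then show ?thesis
        using assms(2) x by (intro wins_from_mono[OF cert[of 1 4 14]]) (auto simp: mem)
    next
      case 6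
      then show ?thesis
        using assms(2) x by (intro wins_from_mono[OF cert[of 1 5 8]]) (auto simp: mem)
    qed
  qed
qed

subsection \<open>Balanced play\<close>

text \<open>Doubling avoids division: \<open>r * r + r + 2\<close> is twice
  \<open>1 + r + (r choose 2)\<close>.\<close>

definition twice_weight :: "nat \<Rightarrow> int \<Rightarrow> int \<Rightarrow> int \<Rightarrow> int" where
  "twice_weight r x0 x1 x2 =
     x0 * (int r * int r + int r + 2) + 2 * (int r + 1) * x1 + 2 * x2"

text \<open>\<open>D\<close> is twice the imbalance. The successor weights add up to the weight of
  the state and differ by the imbalance.\<close>

lemma twice_weight_children:
  fixes r :: nat and d0 d1 d2 :: int
  assumes "x0 + d0 = 2 * a0" "x1 + d1 = 2 * a1" "x2 + d2 = 2 * a2"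
  defines "D \<equiv> d0 * (int r * (int r - 1)) + 2 * d1 * int r + 2 * d2"
  shows "2 * twice_weight r a0 (a1 + x0 - a0) (a2 + x1 - a1) = twice_weight (Suc r) x0 x1 x2 + D"
    and "2 * twice_weight r (x0 - a0) (x1 - a1 + a0) (x2 - a2 + a1) =
      twice_weight (Suc r) x0 x1 x2 - D"
proof -
  have x: "x0 = 2 * a0 - d0" "x1 = 2 * a1 - d1" "x2 = 2 * a2 - d2"
    using assms by linarith+
  show "2 * twice_weight r a0 (a1 + x0 - a0) (a2 + x1 - a1) =
      twice_weight (Suc r) x0 x1 x2 + D"
    unfolding x D_def twice_weight_def by (simp add: algebra_simps)
  show "2 * twice_weight r (x0 - a0) (x1 - a1 + a0) (x2 - a2 + a1) =
      twice_weight (Suc r) x0 x1 x2 - D"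
    unfolding x D_def twice_weight_def by (simp add: algebra_simps)
qed

lemma even_twice_weight: "even (twice_weight r x0 x1 x2)"
  by (simp add: twice_weight_def)

text \<open>
  The invariant of balanced play. The bound \<open>(x0 - 1) * K \<le> 2 ^ r\<close>, with \<open>K\<close> the weight of a chip
  at the start of the game, survives rounding up when \<open>x0\<close> is halved; it keeps part of the
  weight in \<open>x1\<close> and \<open>x2\<close>, and these replenish \<open>x2\<close> in the next round.
\<close>

definition well_stocked :: "int \<Rightarrow> nat \<Rightarrow> int \<Rightarrow> int \<Rightarrow> int \<Rightarrow> bool" where
  "well_stocked K r x0 x1 x2 \<longleftrightarrow> 0 \<le> x0 \<and> 0 \<le> x1 \<and> 0 \<le> x2 \<and>
     2 * 2 ^ r \<le> twice_weight r x0 x1 x2 \<and>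
     (x0 = 0 \<longrightarrow> int r - 1 \<le> x2) \<and>
     (1 \<le> x0 \<longrightarrow> (int r - 1) * (int r - 2) - 4 \<le> 2 * x2 \<and> (x0 - 1) * K \<le> 2 ^ r)"

text \<open>The inequality fails at \<open>r = 13\<close>. It is the reason why the general argument
  requires 14 rounds after the first two.\<close>

lemma two_power_ge_quartic:
  assumes "14 \<le> r"
  shows "int r * int r * (int r * int r + 5 * int r + 6) \<le> 4 * 2 ^ r"
  using assms
proof (induction r rule: dec_induct)
  case (step r)
  \<comment> \<open>Naming the powers of \<open>R\<close> makes the comparison linear, given that
    each power is at least 14 times the previous one.\<close>
  define R where "R = int r"
  define R2 where "R2 = R * R"
  define R3 where "R3 = R * R2"
  define R4 where "R4 = R * R3"
  have R: "14 \<le> R"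
    using step by (simp add: R_def)
  have R2: "14 * R \<le> R2"
    unfolding R2_def using R by (intro mult_right_mono) auto
  have R3: "14 * R2 \<le> R3"
    unfolding R3_def using R R2 by (intro mult_right_mono) auto
  have R4: "14 * R3 \<le> R4"
    unfolding R4_def using R R2 R3 by (intro mult_right_mono) auto
  have "int (Suc r) * int (Suc r) * (int (Suc r) * int (Suc r) + 5 * int (Suc r) + 6)
      = R4 + 9 * R3 + 27 * R2 + 31 * R + 12"
    by (simp add: R_def R2_def R3_def R4_def algebra_simps)
  also have "\<dots> \<le> 2 * R4 + 10 * R3 + 12 * R2"
    using R R2 R3 R4 by linarith
  also have "\<dots> = 2 * (int r * int r * (int r * int r + 5 * int r + 6))"
    by (simp add: R_def R2_def R3_def R4_def algebra_simps)
  also have "\<dots> \<le> 4 * 2 ^ Suc r"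
    using step.IH by simp
  finally show ?case .
qed simp

text \<open>\<open>2 * K\<close> exceeds the doubled weight \<open>R * R + 3 * R + 4\<close> of a
  top chip by at least \<open>2 * R + 2\<close>. Top chips limited by \<open>K\<close> therefore
  cannot use up the doubled weight \<open>4 * 2 ^ r\<close>, and a cubic amount is left for the
  other chips.\<close>

lemma top_weight_bound:
  fixes K x :: int and r :: nat
  defines "R \<equiv> int r"
  assumes "6 \<le> r" "129 \<le> K" "R * R + 5 * R + 6 \<le> 2 * K" "1 \<le> x" "(x - 1) * K \<le> 2 ^ Suc r"
  shows "x * (R * R + 3 * R + 4) + R * (R * R) - 5 * R + 2 \<le> 4 * 2 ^ r"
proof (cases "14 \<le> r")
  case True
  define y where "y = x - 1"
  define Q :: int where "Q = 4 * 2 ^ r"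
  define c where "c = R * R + 3 * R + 4"
  have R: "14 \<le> R"
    using True by (simp add: R_def)
  have y: "0 \<le> y"
    using assms by (simp add: y_def)
  have "y * (c + (2 * R + 2)) \<le> y * (2 * K)"
    using y assms by (intro mult_left_mono) (auto simp: c_def)
  also have "\<dots> \<le> Q"
    using assms(6) by (simp add: y_def Q_def mult.commute)
  finally have yQ: "y * (c + (2 * R + 2)) \<le> Q" .
  have c: "0 \<le> c" "0 < c + (2 * R + 2)"
    using R by (auto simp: c_def intro!: add_nonneg_nonneg add_nonneg_pos)
  \<comment> \<open>All top chips but one leave at least the fraction
    \<open>(2 * R + 2) / (c + (2 * R + 2))\<close> of \<open>Q\<close>.\<close>
  have "c * (y * (c + (2 * R + 2))) \<le> c * Q"
    using yQ c by (intro mult_left_mono)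
  then have low: "(2 * R + 2) * Q \<le> (c + (2 * R + 2)) * (Q - y * c)"
    by (simp add: algebra_simps)
  have quart: "R * R * (c + (2 * R + 2)) \<le> Q"
    using two_power_ge_quartic[OF True] by (simp add: R_def Q_def c_def algebra_simps)
  have "(c + (2 * R + 2)) * (R * (R * R) + R * R - 2 * R + 6)
      \<le> (c + (2 * R + 2)) * (R * (R * R) + R * R)"
    using c R by (intro mult_left_mono) auto
  also have "\<dots> = (R + 1) * (R * R * (c + (2 * R + 2)))"
    by (simp add: algebra_simps)
  also have "\<dots> \<le> (R + 1) * Q"
    using quart R by (intro mult_left_mono) auto
  also have "\<dots> \<le> (2 * R + 2) * Q"
    using R by (intro mult_right_mono) (auto simp: Q_def)
  also note low
  finally have "R * (R * R) + R * R - 2 * R + 6 \<le> Q - y * c"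
    using c by (simp only: mult_le_cancel_left_pos)
  then show ?thesis
    by (simp add: y_def c_def Q_def algebra_simps)
next
  case False
  \<comment> \<open>Since 129 exceeds \<open>2 ^ 7\<close>, only \<open>x = 1\<close> is possible at
    \<open>r = 6\<close>; the other values of \<open>r\<close> are numeric checks.\<close>
  have "(x - 1) * 129 \<le> (x - 1) * K"
    using assms by (intro mult_left_mono) auto
  then have x: "(x - 1) * 129 \<le> 2 ^ Suc r"
    using assms by linarith
  consider "r = 6" "x \<le> 1" | "r = 7" "x \<le> 2" | "r = 8" | "r = 9" | "r = 10" | "r = 11" | "r = 12" | "r = 13"
  proof -
    have "x \<le> 1" if "r = 6"
      using x that by simp
    moreover have "x \<le> 2" if "r = 7"
      using x that by simp
    moreover have "r = 6 \<or> r = 7 \<or> r = 8 \<or> r = 9 \<or> r = 10 \<or> r = 11 \<or> r = 12 \<or> r = 13"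
      using assms(2) False by linarith
    ultimately show ?thesis
      using that by blast
  qed
  then show ?thesis
    using x by cases (simp_all add: R_def)
qed

text \<open>The new third coordinates are half of \<open>x1 + x2\<close> up to half of
  \<open>d2 - d1\<close>, so the last two assumptions restock them. As \<open>d0\<close> is 0 or 1,
  the first coordinates are at most half of \<open>x0 + 1\<close>, which preserves the bound by
  \<open>K\<close>.\<close>

lemma well_stocked_children:
  fixes K :: int and r :: nat
  defines "R \<equiv> int r"
  assumes "6 \<le> r" "0 \<le> K" "well_stocked K (Suc r) x0 x1 x2"
    and a: "x0 + d0 = 2 * a0" "x1 + d1 = 2 * a1" "x2 + d2 = 2 * a2"
    and d: "0 \<le> d0" "d0 \<le> 1" "d0 \<le> x0" "\<bar>d1\<bar> \<le> x1" "\<bar>d2\<bar> \<le> x2"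
    and D: "\<bar>d0 * (R * (R - 1)) + 2 * d1 * R + 2 * d2\<bar> \<le> 2"
    and pos: "1 \<le> x0 \<Longrightarrow> (R - 1) * (R - 2) - 4 + \<bar>d2 - d1\<bar> \<le> x1 + x2"
    and zero: "x0 = 0 \<Longrightarrow> 2 * (R - 1) + \<bar>d2 - d1\<bar> \<le> x1 + x2"
  shows "well_stocked K r a0 (a1 + x0 - a0) (a2 + x1 - a1)"
    and "well_stocked K r (x0 - a0) (x1 - a1 + a0) (x2 - a2 + a1)"
proof -
  let ?wy = "twice_weight r a0 (a1 + x0 - a0) (a2 + x1 - a1)"
  let ?wn = "twice_weight r (x0 - a0) (x1 - a1 + a0) (x2 - a2 + a1)"
  have w: "4 * 2 ^ r \<le> twice_weight (Suc r) x0 x1 x2"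
    using assms(4) by (simp add: well_stocked_def)
  \<comment> \<open>An imbalance of at most 1 leaves a doubled weight at most 1 short of
    \<open>2 * 2 ^ r\<close>; evenness rounds this away.\<close>
  have "4 * 2 ^ r - 2 \<le> 2 * ?wy" "4 * 2 ^ r - 2 \<le> 2 * ?wn"
    using twice_weight_children[OF a, of r] w D unfolding R_def by linarith+
  moreover have "even ?wy" "even ?wn"
    by (rule even_twice_weight)+
  ultimately have wt: "2 * 2 ^ r \<le> ?wy" "2 * 2 ^ r \<le> ?wn"
    by presburger+
  have x0: "0 \<le> x0"
    using assms(4) by (simp add: well_stocked_def)
  have R: "6 \<le> R"
    using assms(2) by (simp add: R_def)
  have "4 * (R - 1) \<le> (R - 2) * (R - 1)"
    using R by (intro mult_right_mono) auto
  \<comment> \<open>The stock required for positive \<open>x0\<close> also covers a child whose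
    first coordinate is 0.\<close>
  then have RR: "2 * (R - 1) \<le> (R - 1) * (R - 2) - 4"
    using R by (simp add: algebra_simps)
  have bound: "(y - 1) * K \<le> 2 ^ r" if "y + y \<le> x0 + 1" "1 \<le> y" for y
  proof -
    have "2 * ((y - 1) * K) = (2 * y - 2) * K"
      by (simp add: algebra_simps)
    also have "\<dots> \<le> (x0 - 1) * K"
      using that assms(3) by (intro mult_right_mono) auto
    also have "\<dots> \<le> 2 * 2 ^ r"
      using assms(4) that by (auto simp: well_stocked_def)
    finally show ?thesis by simp
  qed
  have y2: "2 * (a2 + x1 - a1) = x1 + x2 + (d2 - d1)"
    and n2: "2 * (x2 - a2 + a1) = x1 + x2 - (d2 - d1)"
    using a by simp_all
  show "well_stocked K r a0 (a1 + x0 - a0) (a2 + x1 - a1)"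
    unfolding well_stocked_def R_def[symmetric]
  proof (intro conjI impI)
    show "R - 1 \<le> a2 + x1 - a1"
      using a pos zero x0 RR by (cases "x0 = 0") force+
  next
    assume "1 \<le> a0"
    then have "(R - 1) * (R - 2) - 4 + \<bar>d2 - d1\<bar> \<le> x1 + x2"
      using a d by (intro pos) linarith
    then show "(R - 1) * (R - 2) - 4 \<le> 2 * (a2 + x1 - a1)"
      unfolding y2 by linarith
  next
    assume "1 \<le> a0"
    then show "(a0 - 1) * K \<le> 2 ^ r"
      using a d by (intro bound) linarith+
  qed (use a d wt x0 in linarith)+
  show "well_stocked K r (x0 - a0) (x1 - a1 + a0) (x2 - a2 + a1)"
    unfolding well_stocked_def R_def[symmetric]
  proof (intro conjI impI)
    show "R - 1 \<le> x2 - a2 + a1"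
      using a pos zero x0 RR by (cases "x0 = 0") force+
  next
    assume "1 \<le> x0 - a0"
    then have "(R - 1) * (R - 2) - 4 + \<bar>d2 - d1\<bar> \<le> x1 + x2"
      using a d by (intro pos) linarith
    then show "(R - 1) * (R - 2) - 4 \<le> 2 * (x2 - a2 + a1)"
      unfolding n2 by linarith
  next
    assume "1 \<le> x0 - a0"
    then show "(x0 - a0 - 1) * K \<le> 2 ^ r"
      using a d by (intro bound) linarith+
  qed (use a d wt x0 in linarith)+
qed

lemma two_power_gt_square:
  assumes "7 \<le> r"
  shows "2 * (int r * int r) < 2 ^ r + 4"
  using assms
proof (induction r rule: dec_induct)
  case (step r)
  define R where "R = int r"
  have "7 * R \<le> R * R"
    using step by (intro mult_right_mono) (auto simp: R_def)
  moreover have "2 * (R * R) < 2 ^ r + 4"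
    using step.IH by (simp add: R_def)
  moreover have "int (Suc r) * int (Suc r) = R * R + 2 * R + 1"
    by (simp add: R_def algebra_simps)
  moreover have "7 \<le> R"
    using step by (simp add: R_def)
  moreover have "(2::int) ^ Suc r = 2 * 2 ^ r"
    by simp
  ultimately show ?case by linarith
qed simp

text \<open>Weight not carried by \<open>x0\<close> lies in \<open>x1\<close> and \<open>x2\<close>.
  A chip of \<open>x1\<close> weighs \<open>R + 2\<close> and one of \<open>x2\<close> weighs 1, so
  adding \<open>R + 1\<close> times the invariant's bound on \<open>x2\<close> turns the weight
  estimate into one for the number \<open>x1 + x2\<close>.\<close>

lemma well_stocked_lower_chips:
  fixes K :: int and r :: nat
  defines "R \<equiv> int r"
  assumes "6 \<le> r" "129 \<le> K" "R * R + 5 * R + 6 \<le> 2 * K" "well_stocked K (Suc r) x0 x1 x2"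
  shows "x0 = 0 \<Longrightarrow> 3 * R \<le> x1 + x2"
    and "1 \<le> x0 \<Longrightarrow> R * R - 2 * R \<le> x1 + x2"
    and "1 \<le> x0 \<Longrightarrow> R * (R * R) - 5 * R + 2 \<le> 2 * (R + 2) * x1 + 2 * x2"
proof -
  have R: "6 \<le> R"
    using assms by (simp add: R_def)
  have w: "4 * 2 ^ r \<le> x0 * (R * R + 3 * R + 4) + 2 * (R + 2) * x1 + 2 * x2"
    using assms(5) by (simp add: well_stocked_def twice_weight_def R_def algebra_simps)
  show low: "R * (R * R) - 5 * R + 2 \<le> 2 * (R + 2) * x1 + 2 * x2" if "1 \<le> x0"
    using w top_weight_bound[of r K x0] that assms(2-5)
    unfolding R_def well_stocked_def by linarith
  show "R * R - 2 * R \<le> x1 + x2" if "1 \<le> x0"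
  proof -
    have x2: "R * (R * (R - 1) - 4) + (R * (R - 1) - 4) \<le> R * (2 * x2) + 2 * x2"
    proof -
      have "R * (R - 1) - 4 \<le> 2 * x2"
        using assms(5) that by (simp add: well_stocked_def R_def)
      then show ?thesis
        using R by (intro add_mono mult_left_mono) auto
    qed
    \<comment> \<open>The estimate falls just short of \<open>R * R - 2 * R\<close>; a strict
      comparison with one less, together with integrality, closes the gap.\<close>
    have "2 * (R + 2) * (R * R - 2 * R - 1) < 2 * (R + 2) * (x1 + x2)"
      using low[OF that] x2 R by (simp add: algebra_simps)
    then have "R * R - 2 * R - 1 < x1 + x2"
      using R by (simp add: mult_less_cancel_left)
    then show ?thesis by simp
  qed
  show "3 * R \<le> x1 + x2" if "x0 = 0"
  proof -
    have x2: "R * R + R \<le> R * x2 + x2"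
      using assms(5) that R
      by (intro add_mono mult_left_mono) (auto simp: well_stocked_def R_def)
    have "2 * ((R + 1) * (R + 1)) < 2 * 2 ^ r + 4"
      using two_power_gt_square[of "Suc r"] assms(2) by (simp add: R_def add.commute)
    then have "(R + 2) * (3 * R - 1) < (R + 2) * (x1 + x2)"
      using w x2 that by (simp add: algebra_simps)
    then have "3 * R - 1 < x1 + x2"
      using R by (simp add: mult_less_cancel_left)
    then show ?thesis by simp
  qed
qed

text \<open>Of two consecutive integers one has the parity of \<open>x\<close>. This lets
  \<open>d2\<close> cancel a prescribed imbalance up to 1.\<close>

lemma exists_near_parity:
  fixes x t :: int
  obtains d a where "x + d = 2 * a" "t \<le> d" "d \<le> t + 1"
proof (cases "even (x + t)")
  case True
  then show ?thesis
    using that[of t "(x + t) div 2"] by simp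
next
  case False
  then have "x + (t + 1) = 2 * ((x + t + 1) div 2)"
    by presburger
  then show ?thesis
    by (rule that) simp_all
qed

text \<open>\<open>d0\<close> is the parity of \<open>x0\<close>. Then \<open>d1\<close> either
  stays within 1 of 0 or cancels most of the contribution of \<open>d0\<close>, and
  \<open>d2\<close> absorbs the rest up to 1, which the stock in \<open>x2\<close> permits.\<close>

lemma well_stocked_step:
  fixes K :: int and r :: nat
  defines "R \<equiv> int r"
  assumes r: "6 \<le> r" and K: "129 \<le> K" "R * R + 5 * R + 6 \<le> 2 * K"
    and ws: "well_stocked K (Suc r) x0 x1 x2"
  obtains d0 d1 d2 a0 a1 a2
  where "x0 + d0 = 2 * a0" "x1 + d1 = 2 * a1" "x2 + d2 = 2 * a2"
    and "0 \<le> d0" "d0 \<le> 1" "d0 \<le> x0" "\<bar>d1\<bar> \<le> x1" "\<bar>d2\<bar> \<le> x2"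
    and "\<bar>d0 * (R * (R - 1)) + 2 * d1 * R + 2 * d2\<bar> \<le> 2"
    and "1 \<le> x0 \<Longrightarrow> (R - 1) * (R - 2) - 4 + \<bar>d2 - d1\<bar> \<le> x1 + x2"
    and "x0 = 0 \<Longrightarrow> 2 * (R - 1) + \<bar>d2 - d1\<bar> \<le> x1 + x2"
proof -
  have R: "6 \<le> R"
    using r by (simp add: R_def)
  have RR: "6 * R \<le> R * R"
    using R by (intro mult_right_mono) auto
  note low = well_stocked_lower_chips[OF r K[unfolded R_def] ws, folded R_def]
  have x: "0 \<le> x0" "0 \<le> x1" "0 \<le> x2"
    using ws by (simp_all add: well_stocked_def)
  have expand: "(R - 1) * (R - 2) = R * R - 3 * R + 2" "R * (R - 1) = R * R - R"
    "(R + 2) * (R - 1) = R * R + R - 2"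
    by (simp_all add: algebra_simps)
  have x2_pos: "R + 1 \<le> x2" if "1 \<le> x0"
  proof -
    have "R * (R - 1) - 4 \<le> 2 * x2"
      using ws that by (simp add: well_stocked_def R_def)
    then show ?thesis
      using R RR unfolding expand by linarith
  qed
  have x2_zero: "R \<le> x2" if "x0 = 0"
    using ws that by (simp add: well_stocked_def R_def)
  show ?thesis
  proof (cases "even x0")
    case True
    define d1 where "d1 = x1 mod 2"
    obtain d2 a2 where d2: "x2 + d2 = 2 * a2" "- d1 * R \<le> d2" "d2 \<le> - d1 * R + 1"
      by (rule exists_near_parity)
    have x2: "R \<le> x2"
      using x2_pos x2_zero x by linarith
    have d1: "d1 = 0 \<or> d1 = 1" "x1 + d1 = 2 * (x1 - x1 div 2)" "\<bar>d1\<bar> \<le> x1"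
      using x unfolding d1_def by presburger+
    have b: "\<bar>d2\<bar> \<le> x2" "\<bar>d2 - d1\<bar> \<le> R + 2" "\<bar>2 * d1 * R + 2 * d2\<bar> \<le> 2"
      using d1(1) d2 R x2 by auto
    show ?thesis
    proof (rule that[of 0 "x0 div 2" d1 "x1 - x1 div 2" d2 a2])
      show "(R - 1) * (R - 2) - 4 + \<bar>d2 - d1\<bar> \<le> x1 + x2" if "1 \<le> x0"
        using low(2)[OF that] b(2) unfolding expand by linarith
      show "2 * (R - 1) + \<bar>d2 - d1\<bar> \<le> x1 + x2" if "x0 = 0"
        using low(1)[OF that] b(2) by simp
      show "x1 + d1 = 2 * (x1 - x1 div 2)"
        by (fact d1(2))
    qed (use True d1(3) d2(1) b x in auto)
  next
    case False
    then have x0: "1 \<le> x0" "x0 + 1 = 2 * ((x0 + 1) div 2)"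
      using x by presburger+
    obtain h where h: "R * (R - 1) = 2 * h"
      using evenE[of "R * (R - 1)"] by auto
    show ?thesis
    proof (cases "R \<le> 2 * x1")
      case True
      \<comment> \<open>The imbalance from \<open>d0 = 1\<close> is \<open>R * (R - 1) / 2\<close>; about \<open>R / 2\<close> chips of \<open>x1\<close> compensate it.\<close>
      define s where "s = (R + 2 * x1) div 4"
      define d1 where "d1 = x1 - 2 * s"
      \<comment> \<open>\<open>e + 1\<close> is the residue of \<open>R + 2 * x1\<close> modulo 4,
        and \<open>R * e\<close> is twice the imbalance that remains for \<open>d2\<close>.\<close>
      define e where "e = R - 1 + 2 * d1"
      have e: "e = -1 \<or> e = 0 \<or> e = 1 \<or> e = 2"
        unfolding e_def d1_def s_def by presburger
      have s: "0 \<le> s"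
        using R x by (simp add: s_def)
      have d1: "\<bar>d1\<bar> \<le> x1"
        using e s True x e_def d1_def by linarith
      define g where "g = h + d1 * R"
      obtain d2 a2 where d2: "x2 + d2 = 2 * a2" "- g \<le> d2" "d2 \<le> - g + 1"
        by (rule exists_near_parity)
      have "2 * g = R * e"
        using h by (simp add: g_def e_def algebra_simps)
      moreover have "2 * d1 = e + 1 - R"
        by (simp add: e_def)
      ultimately have "2 * g = - R \<and> 2 * d1 = - R \<or> 2 * g = 0 \<and> 2 * d1 = 1 - R \<or>
          2 * g = R \<and> 2 * d1 = 2 - R \<or> 2 * g = 2 * R \<and> 2 * d1 = 3 - R"
        using e by (elim disjE) simp_all
      then have b: "\<bar>d2\<bar> \<le> R + 1" "\<bar>d2 - d1\<bar> \<le> R + 2"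
        using d2 R by linarith+
      show ?thesis
      proof (rule that[of 1 "(x0 + 1) div 2" d1 "x1 - s" d2 a2])
        show "(R - 1) * (R - 2) - 4 + \<bar>d2 - d1\<bar> \<le> x1 + x2"
          using low(2)[OF x0(1)] b(2) unfolding expand by linarith
        show "\<bar>1 * (R * (R - 1)) + 2 * d1 * R + 2 * d2\<bar> \<le> 2"
          using h d2 by (simp add: g_def)
        show "\<bar>d2\<bar> \<le> x2"
          using b x2_pos[OF x0(1)] by linarith
        show "x1 + d1 = 2 * (x1 - s)"
          by (simp add: d1_def)
      qed (use x0 d1 d2(1) in auto)
    next
      case False
      \<comment> \<open>Here \<open>x1\<close> is small, so almost all weight sits in \<open>x2\<close>, which compensates alone.\<close>
      define d1 where "d1 = - (x1 mod 2)"
      obtain d2 a2 where d2: "x2 + d2 = 2 * a2" "- (h + d1 * R) \<le> d2" "d2 \<le> - (h + d1 * R) + 1"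
        by (rule exists_near_parity)
      have d1: "d1 = 0 \<or> d1 = -1" "x1 + d1 = 2 * (x1 div 2)" "\<bar>d1\<bar> \<le> x1"
        using x unfolding d1_def by presburger+
      have hR: "5 * R \<le> 2 * h"
        using h RR unfolding expand by linarith
      have b: "\<bar>d2\<bar> \<le> h" "\<bar>d2 - d1\<bar> \<le> h + 1"
        using d1(1) d2 hR R by auto
      have "(R + 2) * (2 * x1) \<le> (R + 2) * (R - 1)"
        using False R by (intro mult_left_mono) auto
      then have "R * (R * R) - 5 * R + 2 - (R + 2) * (R - 1) \<le> 2 * x2"
        using low(3)[OF x0(1)] by (simp add: algebra_simps)
      moreover have "6 * (R * R) \<le> R * (R * R)"
        using R by (intro mult_right_mono) auto
      ultimately have x2: "(R - 1) * (R - 2) + (R - 1) * (R - 2) + 2 * h \<le> 2 * x2"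
        using R RR h unfolding expand by linarith
      have "0 \<le> (R - 1) * (R - 2)"
        using R by simp
      show ?thesis
      proof (rule that[of 1 "(x0 + 1) div 2" d1 "x1 div 2" d2 a2])
        show "(R - 1) * (R - 2) - 4 + \<bar>d2 - d1\<bar> \<le> x1 + x2"
          using x2 b(2) x by linarith
        show "\<bar>1 * (R * (R - 1)) + 2 * d1 * R + 2 * d2\<bar> \<le> 2"
          using h d2 by simp
        show "\<bar>d2\<bar> \<le> x2"
          using b x2 \<open>0 \<le> (R - 1) * (R - 2)\<close> by linarith
        show "x1 + d1 = 2 * (x1 div 2)"
          by (fact d1(2))
      qed (use x0 d1(3) d2(1) in auto)
    qed
  qed
qed

text \<open>Induction down to the table for 6 rounds, where \<open>129 <= K\<close> leaves only 0
  and 1 for \<open>x0\<close>. The assumption on \<open>K\<close> at \<open>r + 1\<close> is the one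
  \<open>well_stocked_step\<close> asks for at \<open>r\<close>.\<close>

lemma wins_from_well_stocked:
  assumes "6 \<le> r" "129 \<le> K" "int r * int r + 3 * int r + 2 \<le> 2 * K" "well_stocked K r x0 x1 x2"
  shows "wins_from r x0 x1 x2"
  using assms
proof (induction r arbitrary: x0 x1 x2 rule: dec_induct)
  case base
  have x: "0 \<le> x0" "0 \<le> x1"
    using base by (simp_all add: well_stocked_def)
  have "x0 \<le> 1"
  proof (rule ccontr)
    assume "\<not> x0 \<le> 1"
    then have "1 * 129 \<le> (x0 - 1) * K"
      using base by (intro mult_mono) auto
    then show False
      using base \<open>\<not> x0 \<le> 1\<close> by (simp add: well_stocked_def)
  qed
  then have "x0 = 0 \<or> x0 = 1"
    using x by linarith
  then show ?case
    using base x by (intro wins_from_6) (auto simp: well_stocked_def twice_weight_def)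
next
  case (step r)
  have K: "int r * int r + 5 * int r + 6 \<le> 2 * K"
    using step.prems(2) by (simp add: algebra_simps)
  have K': "int r * int r + 3 * int r + 2 \<le> 2 * K"
    using K by linarith
  from step.hyps(1) step.prems(1) K step.prems(3) show ?case
  proof (rule well_stocked_step)
    fix d0 d1 d2 a0 a1 a2
    assume a: "x0 + d0 = 2 * a0" "x1 + d1 = 2 * a1" "x2 + d2 = 2 * a2"
      and d: "0 \<le> d0" "d0 \<le> 1" "d0 \<le> x0" "\<bar>d1\<bar> \<le> x1" "\<bar>d2\<bar> \<le> x2"
      and rest: "\<bar>d0 * (int r * (int r - 1)) + 2 * d1 * int r + 2 * d2\<bar> \<le> 2"
        "1 \<le> x0 \<Longrightarrow> (int r - 1) * (int r - 2) - 4 + \<bar>d2 - d1\<bar> \<le> x1 + x2"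
        "x0 = 0 \<Longrightarrow> 2 * (int r - 1) + \<bar>d2 - d1\<bar> \<le> x1 + x2"
    have K0: "0 \<le> K"
      using step.prems(1) by simp
    note children = well_stocked_children[OF step.hyps(1) K0 step.prems(3) a d rest]
    have "wins_from r a0 (a1 + x0 - a0) (a2 + x1 - a1)"
      "wins_from r (x0 - a0) (x1 - a1 + a0) (x2 - a2 + a1)"
      using step.IH[OF step.prems(1) K'] children by blast+
    then show ?thesis
      using a d by (intro wins_from_step[of a0 _ a1 _ a2]) linarith+
  qed
qed

subsection \<open>The first two rounds\<close>

lemma paul_wins_imp_weight:
  "paul_wins r (x0, x1, x2) \<Longrightarrow> 2 * 2 ^ r \<le> twice_weight r (int x0) (int x1) (int x2)"
proof (induction r arbitrary: x0 x1 x2)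
  case 0
  then show ?case by (simp add: twice_weight_def)
next
  case (Suc r)
  from Suc.prems show ?case
  proof (rule paul_wins_stepE)
    fix a0 a1 a2
    assume a: "a0 \<le> x0" "a1 \<le> x1" "a2 \<le> x2"
      and y: "paul_wins r (a0, a1 + (x0 - a0), a2 + (x1 - a1))"
      and n: "paul_wins r (x0 - a0, x1 - a1 + a0, x2 - a2 + a1)"
    obtain b0 b1 b2 where x: "x0 = a0 + b0" "x1 = a1 + b1" "x2 = a2 + b2"
      using a by (meson nat_le_iff_add)
    have "2 * 2 ^ r \<le> twice_weight r (int a0) (int (a1 + b0)) (int (a2 + b1))"
      "2 * 2 ^ r \<le> twice_weight r (int b0) (int (b1 + a0)) (int (b2 + a1))"
      using Suc.IH[OF y] Suc.IH[OF n] x by simp_all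
    moreover have "twice_weight r (int a0) (int (a1 + b0)) (int (a2 + b1)) +
        twice_weight r (int b0) (int (b1 + a0)) (int (b2 + a1)) =
        twice_weight (Suc r) (int x0) (int x1) (int x2)"
      by (simp add: x twice_weight_def algebra_simps)
    ultimately show ?thesis by simp
  qed
qed

text \<open>Either answer distributes the \<open>n\<close> chips over the first two places. The
  worse outcome of the even split dominates the worse outcome of any other question.\<close>

lemma paul_wins_halve:
  "paul_wins (Suc r) (n, 0, 0) \<longleftrightarrow> paul_wins r (n div 2, n - n div 2, 0)"
proof
  assume "paul_wins (Suc r) (n, 0, 0)"
  then show "paul_wins r (n div 2, n - n div 2, 0)"
  proof (rule paul_wins_stepE)
    fix a0 a1 a2 :: nat
    assume a: "a0 \<le> n" "a1 \<le> 0" "a2 \<le> 0"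
      and y: "paul_wins r (a0, a1 + (n - a0), a2 + (0 - a1))"
      and no: "paul_wins r (n - a0, 0 - a1 + a0, 0 - a2 + a1)"
    have y': "paul_wins r (a0, n - a0, 0)" and n': "paul_wins r (n - a0, a0, 0)"
      using a y no by simp_all
    show ?thesis
    proof (cases "a0 \<le> n div 2")
      case True
      have "dominates (n div 2, n - n div 2, 0) (a0, n - a0, 0)"
        using True a(1) by (simp add: dominates_def)
      then show ?thesis
        using y' paul_wins_mono by blast
    next
      case False
      have "dominates (n div 2, n - n div 2, 0) (n - a0, a0, 0)"
        using False a(1) by (simp add: dominates_def)
      then show ?thesis
        using n' paul_wins_mono by blast
    qed
  qed
next
  assume win: "paul_wins r (n div 2, n - n div 2, 0)"
  have "paul_wins r (n - n div 2, n div 2, 0)"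
    using win by (rule paul_wins_mono) (auto simp: dominates_def)
  then show "paul_wins (Suc r) (n, 0, 0)"
    using win by (intro paul_wins_step[of "n - n div 2" _ 0 _ 0]) simp_all
qed

text \<open>The term \<open>B\<close> of the theorem. For \<open>q = r + 2\<close> it is the least
  value of \<open>\<bar>(r - 1) * d0 + 2 * d1\<bar>\<close> under the parity conditions of the
  second round.\<close>

definition defect :: "nat \<Rightarrow> nat \<Rightarrow> int" where
  "defect q n = (if n mod 4 = 0 then 0
     else if n mod 4 = 1 then 2 * int (q mod 2)
     else if n mod 4 = 2 then (1 - int q ^ 3) mod 4
     else (1 + int q ^ 3) mod 4)"

text \<open>Modulo 4, the cube of an even number vanishes and an odd number equals its cube.\<close>

lemma defect_eq:
  "defect q n = (if n mod 4 = 0 then 0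
     else if n mod 4 = 1 then (if even q then 0 else 2)
     else if even q then 1
     else if (n mod 4 = 2) = (q mod 4 = 1) then 0 else 2)"
proof -
  have "int q ^ 3 mod 4 = (int q mod 4) ^ 3 mod 4"
    by (simp add: power_mod)
  moreover have "int q mod 4 = int (q mod 4)"
    by (simp add: zmod_int)
  ultimately have cube: "int q ^ 3 mod 4 = int (q mod 4) ^ 3 mod 4"
    by simp
  have "(1 - int q ^ 3) mod 4 = (1 - int (q mod 4) ^ 3) mod 4"
    using cube by (metis mod_diff_right_eq)
  moreover have "(1 + int q ^ 3) mod 4 = (1 + int (q mod 4) ^ 3) mod 4"
    using cube by (metis mod_add_right_eq)
  moreover have "q mod 4 = 0 \<and> even q \<or> q mod 4 = 1 \<and> odd q \<or> q mod 4 = 2 \<and> even q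
      \<or> q mod 4 = 3 \<and> odd q"
    by presburger
  ultimately show ?thesis
    unfolding defect_def by (elim disjE conjE) (auto simp: odd_iff_mod_2_eq_one)
qed

text \<open>A defect of 1 is forced by oddness. A defect of 2 is forced because the parities and the
  residue of \<open>r\<close> make the expression congruent to 2 modulo 4.\<close>

lemma imbalance_ge_defect:
  assumes d0: "int (n div 2) + d0 = 2 * a0" and d1: "int (n - n div 2) + d1 = 2 * a1"
  shows "defect (Suc (Suc r)) n \<le> \<bar>(int r - 1) * d0 + 2 * d1\<bar>"
proof -
  let ?e = "(int r - 1) * d0 + 2 * d1"
  have two: "2 \<le> \<bar>?e\<bar>" if "?e = 4 * m + 2" for m
    using that by presburger
  have n: "n mod 4 = 0 \<or> n mod 4 = 1 \<or> n mod 4 = 2 \<or> n mod 4 = 3"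
    by presburger
  have r: "r mod 4 = 0 \<and> even r \<and> Suc (Suc r) mod 4 = 2 \<or>
      r mod 4 = 1 \<and> odd r \<and> Suc (Suc r) mod 4 = 3 \<or>
      r mod 4 = 2 \<and> even r \<and> Suc (Suc r) mod 4 = 0 \<or>
      r mod 4 = 3 \<and> odd r \<and> Suc (Suc r) mod 4 = 1"
    by presburger
  from n r have "defect (Suc (Suc r)) n = 0 \<or>
      defect (Suc (Suc r)) n = 1 \<and> even r \<and> (n mod 4 = 2 \<or> n mod 4 = 3) \<or>
      defect (Suc (Suc r)) n = 2 \<and> odd r \<and> n mod 4 = 1 \<or>
      defect (Suc (Suc r)) n = 2 \<and> r mod 4 = 1 \<and> n mod 4 = 2 \<or>
      defect (Suc (Suc r)) n = 2 \<and> r mod 4 = 3 \<and> n mod 4 = 3"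
    by (elim disjE conjE) (simp_all add: defect_eq)
  then consider "defect (Suc (Suc r)) n = 0"
    | "defect (Suc (Suc r)) n = 1" "even r" "n mod 4 = 2 \<or> n mod 4 = 3"
    | "defect (Suc (Suc r)) n = 2" "odd r" "n mod 4 = 1"
    | "defect (Suc (Suc r)) n = 2" "r mod 4 = 1" "n mod 4 = 2"
    | "defect (Suc (Suc r)) n = 2" "r mod 4 = 3" "n mod 4 = 3"
    by blast
  then show ?thesis
  proof cases
    case 1
    then show ?thesis by simp
  next
    case 2
    have "odd d0"
      using 2(3) d0 by presburger
    then have "odd ?e"
      using 2(2) by simp
    then have "?e \<noteq> 0"
      by (metis even_zero)
    then show ?thesis
      using 2(1) by simp
  next
    case 3
    have "even d0" "odd d1"
      using 3(3) d0 d1 by presburger+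
    then obtain u v where uv: "d0 = 2 * u" "d1 = 2 * v + 1"
      by (metis evenE oddE)
    obtain s where s: "int r = 2 * s + 1"
      using 3(2) by (metis even_of_nat oddE)
    have "?e = 4 * (s * u + v) + 2"
      by (simp add: uv s algebra_simps)
    then show ?thesis
      unfolding 3(1) by (rule two)
  next
    case 4
    have "odd d1"
      using 4(3) d1 by presburger
    then obtain v where v: "d1 = 2 * v + 1"
      by (metis oddE)
    obtain s where s: "int r = 4 * s + 1"
      using 4(2) by (metis add.commute int_ops(2) mult_div_mod_eq of_nat_mod of_nat_numeral)
    have "?e = 4 * (s * d0 + v) + 2"
      by (simp add: v s algebra_simps)
    then show ?thesis
      unfolding 4(1) by (rule two)
  next
    case 5
    have "odd d0" "even d1"
      using 5(3) d0 d1 by presburger+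
    then obtain u v where uv: "d0 = 2 * u + 1" "d1 = 2 * v"
      by (metis evenE oddE)
    obtain s where s: "int r = 4 * s + 3"
      using 5(2) by (metis add.commute mult_div_mod_eq of_nat_mod of_nat_numeral)
    have "?e = 4 * (s * (2 * u + 1) + u + v) + 2"
      by (simp add: uv s algebra_simps)
    then show ?thesis
      unfolding 5(1) by (rule two)
  qed
qed

text \<open>Converse of \<open>imbalance_ge_defect\<close>, with witnesses by residues modulo 4. The
  value \<open>d0 = 2\<close> occurs for \<open>n mod 4 = 1\<close> and even \<open>r\<close>: the
  defect is 0, and \<open>d0 = 0\<close> would force \<open>d1 = 0\<close> although
  \<open>d1\<close> is odd. The other bounds serve legality and the invariant of balanced
  play.\<close>

lemma exists_imbalance_le_defect:
  fixes n r :: nat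
  obtains d0 a0 d1 a1
  where "int (n div 2) + d0 = 2 * a0" "int (n - n div 2) + d1 = 2 * a1"
    and "0 \<le> d0" "d0 \<le> 2" "\<bar>d1\<bar> \<le> int r + 1"
    and "\<bar>(int r - 1) * d0 + 2 * d1\<bar> \<le> defect (Suc (Suc r)) n"
    and "a0 \<le> int (n div 4) + (if n mod 4 = 0 then 0 else 1)"
proof -
  define k where "k = int (n div 4)"
  define i where "i = n mod 4"
  have k: "int n = 4 * k + int i"
    unfolding k_def i_def by (metis mult_div_mod_eq of_nat_add of_nat_mult of_nat_numeral)
  have half: "int (n div 2) = u" "int (n - n div 2) = int n - u"
    if "2 * u \<le> int n" "int n < 2 * u + 2" for u
    using that by linarith+
  have "i < 4"
    by (simp add: i_def)
  then have "i = 0 \<or> i = 1 \<or> i = 2 \<or> i = 3"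
    by linarith
  then have cases: "i = 0 \<and> int (n div 2) = 2 * k \<and> int (n - n div 2) = 2 * k \<or>
      i = 1 \<and> int (n div 2) = 2 * k \<and> int (n - n div 2) = 2 * k + 1 \<or>
      i = 2 \<and> int (n div 2) = 2 * k + 1 \<and> int (n - n div 2) = 2 * k + 1 \<or>
      i = 3 \<and> int (n div 2) = 2 * k + 1 \<and> int (n - n div 2) = 2 * k + 2"
  proof (elim disjE)
    assume i: "i = 0"
    have "int n = 2 * k + (2 * k)"
      using k i by simp
    then have "int (n div 2) = 2 * k" "int (n - n div 2) = 2 * k"
      using half[of "2 * k"] by linarith+
    then show ?thesis
      using i by blast
  next
    assume i: "i = 1"
    have "int n = 2 * k + (2 * k + 1)"
      using k i by simp
    then have "int (n div 2) = 2 * k" "int (n - n div 2) = 2 * k + 1"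
      using half[of "2 * k"] by linarith+
    then show ?thesis
      using i by blast
  next
    assume i: "i = 2"
    have "int n = 2 * k + 1 + (2 * k + 1)"
      using k i by simp
    then have "int (n div 2) = 2 * k + 1" "int (n - n div 2) = 2 * k + 1"
      using half[of "2 * k + 1"] by linarith+
    then show ?thesis
      using i by blast
  next
    assume i: "i = 3"
    have "int n = 2 * k + 1 + (2 * k + 2)"
      using k i by simp
    then have "int (n div 2) = 2 * k + 1" "int (n - n div 2) = 2 * k + 2"
      using half[of "2 * k + 1"] by linarith+
    then show ?thesis
      using i by blast
  qed
  define s where "s = int (r div 4)"
  have r: "int r = 4 * s \<and> even r \<and> Suc (Suc r) mod 4 = 2 \<or>
      int r = 4 * s + 1 \<and> odd r \<and> Suc (Suc r) mod 4 = 3 \<or>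
      int r = 4 * s + 2 \<and> even r \<and> Suc (Suc r) mod 4 = 0 \<or>
      int r = 4 * s + 3 \<and> odd r \<and> Suc (Suc r) mod 4 = 1"
    unfolding s_def by presburger
  have s: "0 \<le> s"
    by (simp add: s_def)
  note that' = that[folded k_def i_def]
  note defect = defect_eq[of _ n, folded i_def]
  from cases consider
    (c0) "i = 0" "int (n div 2) = 2 * k" "int (n - n div 2) = 2 * k"
    | (c1) "i = 1" "int (n div 2) = 2 * k" "int (n - n div 2) = 2 * k + 1"
    | (c2) "i = 2" "int (n div 2) = 2 * k + 1" "int (n - n div 2) = 2 * k + 1"
    | (c3) "i = 3" "int (n div 2) = 2 * k + 1" "int (n - n div 2) = 2 * k + 2"
    by blast
  then show ?thesis
  proof cases
    case c0
    then show ?thesis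
      by (intro that'[of 0 k 0 k]) (simp_all add: defect)
  next
    case c1
    from r show ?thesis
    proof (elim disjE conjE, goal_cases)
      case 1
      then show ?case using c1 s
        by (intro that'[of "2" "k + 1" "1 - 4 * s" "k + 1 - 2 * s"]) (simp_all add: defect del: of_nat_diff)
    next
      case 2
      then show ?case using c1 s
        by (intro that'[of "0" "k" "1" "k + 1"]) (simp_all add: defect del: of_nat_diff)
    next
      case 3
      then show ?case using c1 s
        by (intro that'[of "2" "k + 1" "- 1 - 4 * s" "k - 2 * s"]) (simp_all add: defect del: of_nat_diff)
    next
      case 4
      then show ?case using c1 s
        by (intro that'[of "0" "k" "1" "k + 1"]) (simp_all add: defect del: of_nat_diff)
    qed
  next
    case c2
    from r show ?thesis
    proof (elim disjE conjE, goal_cases)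
      case 1
      then show ?case using c2 s
        by (intro that'[of "1" "k + 1" "1 - 2 * s" "k + 1 - s"]) (simp_all add: defect del: of_nat_diff)
    next
      case 2
      then show ?case using c2 s
        by (intro that'[of "1" "k + 1" "1 - 2 * s" "k + 1 - s"]) (simp_all add: defect del: of_nat_diff)
    next
      case 3
      then show ?case using c2 s
        by (intro that'[of "1" "k + 1" "- 1 - 2 * s" "k - s"]) (simp_all add: defect del: of_nat_diff)
    next
      case 4
      then show ?case using c2 s
        by (intro that'[of "1" "k + 1" "- 1 - 2 * s" "k - s"]) (simp_all add: defect del: of_nat_diff)
    qed
  next
    case c3
    from r show ?thesis
    proof (elim disjE conjE, goal_cases)
      case 1
      then show ?case using c3 s
        by (intro that'[of "1" "k + 1" "- 2 * s" "k + 1 - s"]) (simp_all add: defect del: of_nat_diff)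
    next
      case 2
      then show ?case using c3 s
        by (intro that'[of "1" "k + 1" "- 2 * s" "k + 1 - s"]) (simp_all add: defect del: of_nat_diff)
    next
      case 3
      then show ?case using c3 s
        by (intro that'[of "1" "k + 1" "- 2 * s" "k + 1 - s"]) (simp_all add: defect del: of_nat_diff)
    next
      case 4
      then show ?case using c3 s
        by (intro that'[of "1" "k + 1" "- 2 * s" "k + 1 - s"]) (simp_all add: defect del: of_nat_diff)
    qed
  qed
qed

text \<open>After the even split \<open>x2 = 0\<close> forces \<open>a2 = 0\<close>, so twice the
  imbalance is a multiple \<open>e * r\<close> with \<open>e\<close> at least the defect in absolute
  value. The lighter successor must still weigh \<open>2 ^ r\<close>.\<close>

lemma paul_wins_imp_bound:
  assumes "paul_wins (Suc (Suc r)) (n, 0, 0)"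
  shows "4 * 2 ^ r + defect (Suc (Suc r)) n * int r
    \<le> twice_weight (Suc r) (int (n div 2)) (int (n - n div 2)) 0"
proof -
  define x0 x1 where "x0 = n div 2" and "x1 = n - n div 2"
  have "paul_wins (Suc r) (x0, x1, 0)"
    using assms paul_wins_halve unfolding x0_def x1_def by blast
  then show ?thesis
  proof (rule paul_wins_stepE)
    fix a0 a1 a2
    assume a: "a0 \<le> x0" "a1 \<le> x1" "a2 \<le> (0::nat)"
      and y: "paul_wins r (a0, a1 + (x0 - a0), a2 + (x1 - a1))"
      and no: "paul_wins r (x0 - a0, x1 - a1 + a0, 0 - a2 + a1)"
    define d0 d1 where "d0 = 2 * int a0 - int x0" and "d1 = 2 * int a1 - int x1"
    define e where "e = (int r - 1) * d0 + 2 * d1"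
    have d: "int x0 + d0 = 2 * int a0" "int x1 + d1 = 2 * int a1" "0 + 0 = 2 * (0::int)"
      by (simp_all add: d0_def d1_def)
    have "2 * 2 ^ r \<le> twice_weight r (int a0) (int a1 + int x0 - int a0) (0 + int x1 - int a1)"
      "2 * 2 ^ r \<le> twice_weight r (int x0 - int a0) (int x1 - int a1 + int a0) (0 - 0 + int a1)"
      using paul_wins_imp_weight[OF y] paul_wins_imp_weight[OF no] a
      by (simp_all add: of_nat_diff algebra_simps)
    moreover have "d0 * (int r * (int r - 1)) + 2 * d1 * int r + 2 * 0 = e * int r"
      by (simp add: e_def algebra_simps)
    ultimately have "4 * 2 ^ r + \<bar>e * int r\<bar> \<le> twice_weight (Suc r) (int x0) (int x1) 0"
      using twice_weight_children[OF d, of r] by linarith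
    moreover have "defect (Suc (Suc r)) n * int r \<le> \<bar>e\<bar> * int r"
      using imbalance_ge_defect[OF d(1,2)[unfolded x0_def x1_def]] unfolding e_def
      by (intro mult_right_mono) auto
    ultimately show ?thesis
      by (simp add: abs_mult x0_def x1_def)
  qed
qed

text \<open>\<open>K\<close> is the weight of a chip with \<open>r + 2\<close> rounds left. After
  two rounds the first coordinate is at most \<open>n div 4\<close>, plus 1 unless 4 divides
  \<open>n\<close>, so \<open>top\<close> is the invariant's bound on it.\<close>

lemma paul_wins_balanced_start:
  fixes n r :: nat and K :: int
  assumes r: "14 \<le> r" and K: "2 * K = int r * int r + 5 * int r + 8"
    and bound: "4 * 2 ^ r + defect (Suc (Suc r)) n * int r
      \<le> twice_weight (Suc r) (int (n div 2)) (int (n - n div 2)) 0"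
    and top: "(int (n div 4) - (if n mod 4 = 0 then 1 else 0)) * K \<le> 2 ^ r"
  shows "paul_wins (Suc (Suc r)) (n, 0, 0)"
proof -
  define R where "R = int r"
  define k where "k = int (n div 4)"
  define x0 x1 where "x0 = int (n div 2)" and "x1 = int (n - n div 2)"
  have R: "14 \<le> R"
    using r by (simp add: R_def)
  have RR: "14 * R \<le> R * R"
    using R by (intro mult_right_mono) auto
  have K': "2 * K = R * R + 5 * R + 8"
    using K by (simp add: R_def)
  have x: "2 * k \<le> x0" "x0 \<le> 2 * k + 1" "2 * k \<le> x1" "x1 \<le> 2 * k + 2"
    unfolding k_def x0_def x1_def by linarith+
  have B: "0 \<le> defect (Suc (Suc r)) n * R"
    by (simp add: defect_eq R_def)
  \<comment> \<open>For smaller \<open>n\<close> the weight would be too small by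
    \<open>two_power_ge_quartic\<close>. A large \<open>k\<close> makes \<open>x1\<close> large, and
    half of \<open>x1\<close> becomes the stock in the third coordinate.\<close>
  have k: "R * R - 2 * R - 1 \<le> 2 * k"
  proof (rule ccontr)
    assume "\<not> ?thesis"
    then have kR: "2 * k + 2 \<le> R * R - 2 * R"
      by linarith
    have "4 * 2 ^ r \<le> x0 * (R * R + 3 * R + 4) + 2 * (R + 2) * x1"
      using bound B by (simp add: twice_weight_def x0_def x1_def R_def algebra_simps)
    also have "\<dots> \<le> (2 * k + 2) * (R * R + 3 * R + 4) + 2 * (R + 2) * (2 * k + 2)"
      using x R by (intro add_mono mult_right_mono mult_left_mono) auto
    also have "\<dots> = (2 * k + 2) * (R * R + 5 * R + 8)"
      by (simp add: algebra_simps)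
    also have "\<dots> \<le> (R * R - 2 * R) * (R * R + 5 * R + 8)"
      using kR R by (intro mult_right_mono) auto
    also have "\<dots> = R * R * (R * R + 5 * R + 6) - (2 * (R * (R * R)) + 8 * (R * R) + 16 * R)"
      by (simp add: algebra_simps)
    also have "\<dots> < R * R * (R * R + 5 * R + 6)"
    proof -
      have "0 \<le> R * R" "0 \<le> R * (R * R)"
        using R by simp_all
      then show ?thesis
        using R by linarith
    qed
    also have "\<dots> \<le> 4 * 2 ^ r"
      using two_power_ge_quartic[OF r] by (simp add: R_def)
    finally show False by simp
  qed
  obtain d0 a0 d1 a1 where d: "x0 + d0 = 2 * a0" "x1 + d1 = 2 * a1"
    and db: "0 \<le> d0" "d0 \<le> 2" "\<bar>d1\<bar> \<le> R + 1"
    and e: "\<bar>(R - 1) * d0 + 2 * d1\<bar> \<le> defect (Suc (Suc r)) n"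
    and a0: "a0 \<le> k + (if n mod 4 = 0 then 0 else 1)"
    using exists_imbalance_le_defect[of n r] unfolding x0_def x1_def R_def k_def by blast
  have z: "0 + 0 = 2 * (0::int)"
    by simp
  note wt = twice_weight_children[OF d z, of r, folded R_def]
  have "\<bar>d0 * (R * (R - 1)) + 2 * d1 * R + 2 * 0\<bar> = \<bar>(R - 1) * d0 + 2 * d1\<bar> * R"
  proof -
    have "d0 * (R * (R - 1)) + 2 * d1 * R + 2 * 0 = ((R - 1) * d0 + 2 * d1) * R"
      by (simp add: algebra_simps)
    then show ?thesis
      using R by (simp add: abs_mult)
  qed
  also have "\<dots> \<le> defect (Suc (Suc r)) n * R"
    using e R by (intro mult_right_mono) auto
  finally have D: "\<bar>d0 * (R * (R - 1)) + 2 * d1 * R + 2 * 0\<bar> \<le> defect (Suc (Suc r)) n * R" .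
  have bound': "4 * 2 ^ r + defect (Suc (Suc r)) n * R \<le> twice_weight (Suc r) x0 x1 0"
    using bound by (simp add: x0_def x1_def R_def)
  have wy: "2 * 2 ^ r \<le> twice_weight r a0 (a1 + x0 - a0) (0 + x1 - a1)"
    and wn: "2 * 2 ^ r \<le> twice_weight r (x0 - a0) (x1 - a1 + a0) (0 - 0 + a1)"
    using wt D bound' by linarith+
  have K129: "129 \<le> K"
    using K' R RR by linarith
  have expand: "(R - 1) * (R - 2) = R * R - 3 * R + 2"
    by (simp add: algebra_simps)
  have top': "(y - 1) * K \<le> 2 ^ r" if "y \<le> a0" for y
  proof -
    have "(y - 1) * K \<le> (k - (if n mod 4 = 0 then 1 else 0)) * K"
      using that a0 K129 by (intro mult_right_mono) (auto split: if_splits)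
    then show ?thesis
      using top unfolding k_def by linarith
  qed
  have stock: "R - 1 \<le> y \<and> (R - 1) * (R - 2) - 4 \<le> 2 * y" if "x1 - (R + 1) \<le> 2 * y" for y
    using that x k R RR unfolding expand by linarith
  have y2: "x1 - (R + 1) \<le> 2 * (0 + x1 - a1)" and n2: "x1 - (R + 1) \<le> 2 * (0 - 0 + a1)"
    using d db by simp_all
  have range: "0 \<le> a0" "a0 \<le> x0" "0 \<le> a1" "a1 \<le> x1"
    using d db x k R RR by linarith+
  have "well_stocked K r a0 (a1 + x0 - a0) (0 + x1 - a1)"
    unfolding well_stocked_def R_def[symmetric]
    using wy stock[OF y2] top' range by auto
  moreover have "well_stocked K r (x0 - a0) (x1 - a1 + a0) (0 - 0 + a1)"
    unfolding well_stocked_def R_def[symmetric]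
    using wn stock[OF n2] top'[of "x0 - a0"] range d db by auto
  ultimately have "wins_from (Suc r) x0 x1 0"
    using range K129 K' r R
    by (intro wins_from_step[of a0 _ a1 _ 0] wins_from_well_stocked[of _ K])
      (auto simp: R_def)
  then have "paul_wins (Suc r) (n div 2, n - n div 2, 0)"
    using wins_from_of_nat[of "Suc r" "n div 2" "n - n div 2" 0] by (simp add: x0_def x1_def)
  then show ?thesis
    using paul_wins_halve by blast
qed

text \<open>Large \<open>n\<close> may violate \<open>top\<close>. It is then replaced by the least
  multiple \<open>4 * j\<close> whose weight \<open>4 * j * K\<close> reaches
  \<open>2 ^ (r + 2)\<close>: its defect is 0, minimality gives \<open>top\<close>, and additional
  chips do no harm.\<close>

lemma paul_wins_of_bound:
  fixes n r :: nat
  assumes r: "14 \<le> r"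
    and bound: "4 * 2 ^ r + defect (Suc (Suc r)) n * int r
      \<le> twice_weight (Suc r) (int (n div 2)) (int (n - n div 2)) 0"
  shows "paul_wins (Suc (Suc r)) (n, 0, 0)"
proof -
  have "even (int r * int r + 5 * int r + 8)"
    by simp
  then obtain K where "int r * int r + 5 * int r + 8 = 2 * K"
    by (rule evenE)
  then have K: "2 * K = int r * int r + 5 * int r + 8"
    by (rule sym)
  have weight: "twice_weight (Suc r) (int (4 * j div 2)) (int (4 * j - 4 * j div 2)) 0
      = 4 * (int j * K)" for j
  proof -
    have "4 * j div 2 = 2 * j"
      by simp
    then have "twice_weight (Suc r) (int (4 * j div 2)) (int (4 * j - 4 * j div 2)) 0
        = 2 * int j * (2 * K)"
      unfolding K by (simp add: twice_weight_def algebra_simps)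
    then show ?thesis by simp
  qed
  show ?thesis
  proof (cases "2 ^ r \<le> int (n div 4) * K")
    case True
    define j where "j = (LEAST j. 2 ^ r \<le> int j * K)"
    have j: "2 ^ r \<le> int j * K"
      unfolding j_def using True by (rule LeastI)
    have jn: "j \<le> n div 4"
      unfolding j_def using True by (rule Least_le)
    have "j \<noteq> 0"
    proof
      assume "j = 0"
      with j have "(2::int) ^ r \<le> 0"
        by simp
      then show False
        by (simp add: not_le)
    qed
    then have "\<not> 2 ^ r \<le> int (j - 1) * K"
      unfolding j_def by (intro not_less_Least) simp
    then have "(int j - 1) * K \<le> 2 ^ r"
      using \<open>j \<noteq> 0\<close> by (simp add: of_nat_diff)
    then have top: "(int (4 * j div 4) - (if 4 * j mod 4 = 0 then 1 else 0)) * K \<le> 2 ^ r"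
      by simp
    have "4 * 2 ^ r + defect (Suc (Suc r)) (4 * j) * int r
        \<le> twice_weight (Suc r) (int (4 * j div 2)) (int (4 * j - 4 * j div 2)) 0"
      unfolding weight using j by (simp add: defect_eq)
    then have "paul_wins (Suc (Suc r)) (4 * j, 0, 0)"
      using top by (rule paul_wins_balanced_start[OF r K])
    then show ?thesis
      by (rule paul_wins_mono) (use jn in \<open>simp add: dominates_def\<close>)
  next
    case False
    have "n mod 4 \<noteq> 0"
    proof
      assume "n mod 4 = 0"
      then have n: "4 * (n div 4) = n"
        by presburger
      have "4 * 2 ^ r \<le> 4 * (int (n div 4) * K)"
        using bound weight[of "n div 4"] \<open>n mod 4 = 0\<close> unfolding n by (simp add: defect_eq)
      then show False
        using False by simp
    qed
    then show ?thesis
      using False by (intro paul_wins_balanced_start[OF r K bound]) simp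
  qed
qed

subsection \<open>The threshold\<close>

lemma twice_choose_two: "2 * int (m choose 2) = int m * (int m - 1)"
proof (cases m)
  case (Suc l)
  have "even (m * (m - 1))"
    by (simp add: Suc)
  then have "2 * (m choose 2) = m * (m - 1)"
    unfolding choose_two by (rule dvd_mult_div_cancel)
  then have "2 * int (m choose 2) = int (m * (m - 1))"
    by (metis of_nat_mult of_nat_numeral)
  then show ?thesis
    by (simp add: Suc algebra_simps)
qed simp

text \<open>The term with \<open>A\<close> is the imbalance of the first round, so subtracting it
  from the weight of \<open>n\<close> chips gives twice the weight of the lighter successor.\<close>

lemma threshold_eq:
  fixes r n :: nat
  defines "q \<equiv> Suc (Suc r)"
  shows "int n * int (1 + q + (q choose 2)) - int (n mod 2) * int ((q - 1) choose 2)
      - B * int ((q - 2) choose 1)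
    = twice_weight (Suc r) (int (n div 2)) (int (n - n div 2)) 0 - B * int r"
proof -
  define m b where "m = int (n div 2)" and "b = int (n mod 2)"
  have n: "int n = 2 * m + b"
    unfolding m_def b_def by (metis mult_div_mod_eq of_nat_add of_nat_mult of_nat_numeral)
  have "n - n div 2 = n div 2 + n mod 2"
    using div_mult_mod_eq[of n 2] by linarith
  then have n': "int (n - n div 2) = m + b"
    by (simp add: m_def b_def)
  have c: "2 * int (q choose 2) = (int r + 2) * (int r + 1)"
    "2 * int ((q - 1) choose 2) = (int r + 1) * int r"
    using twice_choose_two[of q] twice_choose_two[of "q - 1"] by (simp_all add: q_def algebra_simps)
  have "2 * (int n * int (1 + q + (q choose 2)) - b * int ((q - 1) choose 2)
      - B * int ((q - 2) choose 1))
    = int n * (2 + 2 * int q + 2 * int (q choose 2)) - b * (2 * int ((q - 1) choose 2))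
      - 2 * (B * int r)"
    by (simp add: q_def algebra_simps)
  also have "\<dots> = 2 * twice_weight (Suc r) m (m + b) 0 - 2 * (B * int r)"
    unfolding c n twice_weight_def by (simp add: q_def algebra_simps)
  finally have twice: "2 * (int n * int (1 + q + (q choose 2)) - b * int ((q - 1) choose 2)
      - B * int ((q - 2) choose 1)) = 2 * twice_weight (Suc r) m (m + b) 0 - 2 * (B * int r)" .
  have cancel: "x = y - z" if "2 * x = 2 * y - 2 * z" for x y z :: int
    using that by linarith
  show ?thesis
    unfolding m_def[symmetric] b_def[symmetric] n' by (rule cancel[OF twice])
qed

text \<open>Indexed by 0 to 15 rounds. Below the listed size the inequality of the theorem fails by
  evaluation; at it Paul wins by the table, and above it by monotonicity.\<close>

definition least_winning_size :: "nat list" where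
  "least_winning_size = [1, 1, 1, 2, 2, 2, 4, 6, 8, 12, 20, 32, 52, 90, 156, 272]"

lemma paul_wins_least_winning_size:
  assumes "q < 16"
  shows "paul_wins q (least_winning_size ! q, 0, 0)"
proof (cases q)
  case (Suc i)
  \<comment> \<open>The table need not contain the state itself: for 3 rounds \<open>(2,0,0)\<close>
    is covered by \<open>(0,2,0)\<close>.\<close>
  have "list_all (\<lambda>i. list_ex (\<lambda>(x, a). dominates (least_winning_size ! Suc i, 0, 0) x)
      (small_game_certificate ! i)) [0..<15]"
    by code_simp
  then have "list_ex (\<lambda>(x, a). dominates (least_winning_size ! Suc i, 0, 0) x)
      (small_game_certificate ! i)"
    using assms Suc by (simp add: list_all_iff)
  then obtain x a where "(x, a) \<in> set (small_game_certificate ! i)"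
    and dom: "dominates (least_winning_size ! Suc i, 0, 0) x"
    by (auto simp: list_ex_iff)
  then have "paul_wins (Suc i) x"
    using assms Suc by (intro paul_wins_by_certificate) simp_all
  then show ?thesis
    unfolding Suc using dom by (rule paul_wins_mono)
qed (simp add: least_winning_size_def)

lemma least_winning_size_le:
  assumes "q < 16"
    and "(2::int) ^ q \<le> int n * int (1 + q + (q choose 2)) - int (n mod 2) * int ((q - 1) choose 2)
      - defect q n * int ((q - 2) choose 1)"
  shows "least_winning_size ! q \<le> n"
proof (rule ccontr)
  assume "\<not> least_winning_size ! q \<le> n"
  moreover have "list_all (\<lambda>q. list_all (\<lambda>n. \<not> (2::int) ^ q \<le> int n * int (1 + q + (q choose 2))
      - int (n mod 2) * int ((q - 1) choose 2) - defect q n * int ((q - 2) choose 1))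
      [0..<least_winning_size ! q]) [0..<16]"
    by code_simp
  ultimately show False
    using assms by (simp add: list_all_iff)
qed

theorem theorem14:
  fixes q n :: nat
  defines "A \<equiv> int (n mod 2)"
      and "B \<equiv> (if n mod 4 = 0 then 0
                else if n mod 4 = 1 then 2 * int (q mod 2)
                else if n mod 4 = 2 then (1 - int q ^ 3) mod 4
                else (1 + int q ^ 3) mod 4)"
  shows "paul_wins q (n, 0, 0) \<longleftrightarrow>
           (2::int) ^ q \<le> int n * int (1 + q + (q choose 2))
                          - A * int ((q - 1) choose 2) - B * int ((q - 2) choose 1)"
proof -
  have B: "B = defect q n"
    by (simp add: B_def defect_def)
  let ?T = "int n * int (1 + q + (q choose 2))
      - int (n mod 2) * int ((q - 1) choose 2) - defect q n * int ((q - 2) choose 1)"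
  have bound_iff: "(2::int) ^ q \<le> ?T \<longleftrightarrow> 4 * 2 ^ r + defect (Suc (Suc r)) n * int r
      \<le> twice_weight (Suc r) (int (n div 2)) (int (n - n div 2)) 0" if "q = Suc (Suc r)" for r
  proof -
    have "(2::int) ^ q = 4 * 2 ^ r"
      by (simp add: that)
    moreover have "?T = twice_weight (Suc r) (int (n div 2)) (int (n - n div 2)) 0
        - defect q n * int r"
      unfolding that by (rule threshold_eq)
    ultimately show ?thesis
      unfolding that[symmetric] by auto
  qed
  have "paul_wins q (n, 0, 0) \<longleftrightarrow> 2 ^ q \<le> ?T"
  proof
    assume win: "paul_wins q (n, 0, 0)"
    consider "q = 0" | "q = 1" | r where "q = Suc (Suc r)"
      by (metis One_nat_def not0_implies_Suc)
    then show "2 ^ q \<le> ?T"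
    proof cases
      case 3
      then show ?thesis
        using win paul_wins_imp_bound bound_iff by blast
    \<comment> \<open>For \<open>q <= 1\<close> truncated subtraction makes both correction
      binomials 0, so the weight bound is already the claim.\<close>
    qed (use paul_wins_imp_weight[OF win] in \<open>simp_all add: twice_weight_def choose_two\<close>)
  next
    assume T: "2 ^ q \<le> ?T"
    show "paul_wins q (n, 0, 0)"
    proof (cases "q < 16")
      case True
      have "least_winning_size ! q \<le> n"
        using True T by (rule least_winning_size_le)
      then have "dominates (n, 0, 0) (least_winning_size ! q, 0, 0)"
        by (simp add: dominates_def)
      with paul_wins_least_winning_size[OF True] show ?thesis
        by (rule paul_wins_mono)
    next
      case False
      then have q: "q = Suc (Suc (q - 2))"
        by simp
      have "14 \<le> q - 2"
        using False by simp
      then have "paul_wins (Suc (Suc (q - 2))) (n, 0, 0)"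
        using bound_iff[OF q, THEN iffD1, OF T] by (rule paul_wins_of_bound)
      then show ?thesis
        unfolding q[symmetric] .
    qed
  qed
  then show ?thesis
    by (simp add: A_def B)
qed

end
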